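(* Let $N\ge 1$ be an integer, let $a_m(x)=\sum_{i=0}^m a_{m,i}x^i$, $m=1,\ldots,N$, be polynomials with complex coefficients, and let $L=\sum_{i=1}^N a_i(x)\frac{d^i}{dx^i}$. For $n\ge 0$ put $\lambda_n=\sum_{i=1}^{\min\{n,N\}}\binom{n}{i}\,i!\,a_{i,i}$ (so $\lambda_0=0$), and let $M$ be the semi-infinite upper triangular matrix built from $L$ as in the context, with leading principal $(n+1)\times(n+1)$ submatrix $M_{n+1}$. Let $n\ge 1$ and assume that $\lambda_n\ne\lambda_j$ for $j=0,1,\ldots,n-1$. Then there exists a unique monic polynomial $P_n(x)=\sum_{i=0}^n b_{n,i}x^i$ of degree $n$ (so $b_{n,n}=1$) such that $LP_n=\lambda_nP_n$, and its coefficients determine an eigenvector of $M_{n+1}$ corresponding to the eigenvalue $\lambda_n$; that is, $$(M_{n+1}-\lambda_nI_{n+1})\,b_n=0,\qquad b_n=(b_{n,0},\ldots,b_{n,n-1},1)^T .$$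
   Context: Conventions: $a_{0,0}=0$ and $a_{i,j}=0$ whenever $i>N$. For $n\ge 0$ and $0\le k\le n$ define $$\delta_n^{(k)}=\sum_{i=k}^{n}\binom{n}{i}\,i!\,a_{i,i-k}.$$ The matrix $M$ has rows and columns indexed by $0,1,2,\ldots$; its $(r,c)$ entry is $\delta_c^{(c-r)}$ if $0\le c-r\le N$, and $0$ otherwise. Thus its row $r$ has diagonal entry $\delta_r^{(0)}$ followed by $\delta_{r+1}^{(1)},\ldots,\delta_{r+N}^{(N)}$ and then zeros. $I_{n+1}$ is the identity matrix of order $n+1$. *)

theory Defs
  imports "Jordan_Normal_Form.Char_Poly"
begin

text \<open>The operator acts on polynomials, so \<open>d/dx\<close> is the formal derivative.\<close>

definition diff_op :: "nat \<Rightarrow> (nat \<Rightarrow> complex poly) \<Rightarrow> complex poly \<Rightarrow> complex poly" where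
  "diff_op N a P = (\<Sum>i = 1..N. a i * (pderiv ^^ i) P)"

text \<open>The coefficient array of the \<open>a\<^sub>i\<close>. Row \<open>0\<close> and all rows beyond \<open>N\<close> vanish by convention,
  whatever the values of the family \<open>a\<close> there.\<close>

definition op_coeff :: "nat \<Rightarrow> (nat \<Rightarrow> complex poly) \<Rightarrow> nat \<Rightarrow> nat \<Rightarrow> complex" where
  "op_coeff N a i j = (if 1 \<le> i \<and> i \<le> N then poly.coeff (a i) j else 0)"

definition eig_val :: "nat \<Rightarrow> (nat \<Rightarrow> complex poly) \<Rightarrow> nat \<Rightarrow> complex" where
  "eig_val N a n = (\<Sum>i = 1..min n N. of_nat (n choose i) * fact i * op_coeff N a i i)"

text \<open>\<open>op_delta N a n k\<close> is \<open>\<delta>\<close> with lower index \<open>n\<close> and upper index \<open>(k)\<close>.\<close>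

definition op_delta :: "nat \<Rightarrow> (nat \<Rightarrow> complex poly) \<Rightarrow> nat \<Rightarrow> nat \<Rightarrow> complex" where
  "op_delta N a n k = (\<Sum>i = k..n. of_nat (n choose i) * fact i * op_coeff N a i (i - k))"

text \<open>The guard \<open>r \<le> c\<close> is needed because subtraction on the naturals truncates.\<close>

definition op_matrix :: "nat \<Rightarrow> (nat \<Rightarrow> complex poly) \<Rightarrow> nat \<Rightarrow> nat \<Rightarrow> complex" where
  "op_matrix N a r c = (if r \<le> c \<and> c - r \<le> N then op_delta N a c (c - r) else 0)"

text \<open>The leading principal submatrix of order \<open>k\<close>.\<close>

definition op_submatrix :: "nat \<Rightarrow> (nat \<Rightarrow> complex poly) \<Rightarrow> nat \<Rightarrow> complex mat" where
  "op_submatrix N a k = mat k k (\<lambda>(r, c). op_matrix N a r c)"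

definition monic_eigenpoly :: "nat \<Rightarrow> (nat \<Rightarrow> complex poly) \<Rightarrow> nat \<Rightarrow> complex poly \<Rightarrow> bool" where
  "monic_eigenpoly N a n P \<longleftrightarrow>
     degree P = n \<and> lead_coeff P = 1 \<and> diff_op N a P = Polynomial.smult (eig_val N a n) P"

end

theory Submission imports Defs begin

text \<open>Applying \<open>d\<^sup>i/dx\<^sup>i\<close> to \<open>x\<^sup>c\<close> lowers the degree by \<open>i\<close>, and multiplying by \<open>a\<^sub>i\<close> raises it by at most
  \<open>i\<close>. Hence \<open>L\<close> maps \<open>x\<^sup>c\<close> to a polynomial of degree at most \<open>c\<close>, and its coefficients form column
  \<open>c\<close> of \<open>M\<close> (\<open>coeff_diff_op_monom\<close>): \<open>M\<close> is the matrix of \<open>L\<close> in the monomial basis. It is upper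
  triangular with diagonal entries \<open>\<lambda>\<^sub>0, \<lambda>\<^sub>1, \<dots>\<close>, so that on polynomials of degree at most \<open>n\<close> the
  operator \<open>L\<close> acts on coefficient vectors as \<open>M\<^sub>n\<^sub>+\<^sub>1\<close> (\<open>coeff_diff_op\<close>). With this dictionary the
  matrix claim is merely a translation of \<open>L P\<^sub>n = \<lambda>\<^sub>n P\<^sub>n\<close>.

  For existence and uniqueness write \<open>P\<^sub>n = x\<^sup>n + D\<close> with \<open>D\<close> of degree less than \<open>n\<close>. The eigenvalue
  equation becomes \<open>(L - \<lambda>\<^sub>n) D = - (L - \<lambda>\<^sub>n) x\<^sup>n\<close>. Its right-hand side has degree less than \<open>n\<close>,
  because the diagonal entry of \<open>L - \<lambda>\<^sub>n\<close> at \<open>x\<^sup>n\<close> vanishes; the diagonal entries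
  \<open>\<lambda>\<^sub>j - \<lambda>\<^sub>n\<close> with \<open>j < n\<close> do not vanish, so back substitution (\<open>triangular_solve\<close>) gives exactly one
  such \<open>D\<close>.\<close>

section \<open>Triangular operators on polynomials\<close>

text \<open>Linearity alone reduces an operator to its values on monomials. The bound \<open>m\<close> stands for any
  strict upper bound on the degree, so that polynomials with different degrees can be compared in one
  coordinate space.\<close>

lemma coeff_linear_map:
  fixes T :: "'a :: comm_ring_1 poly \<Rightarrow> 'a poly"
  assumes add: "\<And>p q. T (p + q) = T p + T q"
    and scale: "\<And>c p. T (Polynomial.smult c p) = Polynomial.smult c (T p)"
    and bound: "\<And>i. i \<ge> m \<Longrightarrow> poly.coeff P i = 0"
  shows "poly.coeff (T P) r = (\<Sum>c<m. poly.coeff P c * poly.coeff (T (Polynomial.monom 1 c)) r)"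
proof -
  have zero: "T 0 = 0"
    using scale[of 0 0] by simp
  have sums: "T (sum f A) = (\<Sum>x\<in>A. T (f x))" if "finite A" for f and A :: "nat set"
    using that by (induction A rule: finite_induct) (simp_all add: zero add)
  have "P = (\<Sum>c<m. Polynomial.smult (poly.coeff P c) (Polynomial.monom 1 c))"
  proof (rule poly_eqI)
    fix k
    show "poly.coeff P k
        = poly.coeff (\<Sum>c<m. Polynomial.smult (poly.coeff P c) (Polynomial.monom 1 c)) k"
      using bound[of k] by (cases "k < m") (auto simp: coeff_sum if_distrib cong: if_cong)
  qed
  then have "T P = (\<Sum>c<m. Polynomial.smult (poly.coeff P c) (T (Polynomial.monom 1 c)))"
    by (metis (no_types, lifting) sums scale finite_lessThan sum.cong)
  then show ?thesis
    by (simp add: coeff_sum)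
qed

text \<open>Back substitution from the top coefficient downwards: dividing by the nonzero diagonal entry
  fixes the coefficient of the highest monomial, and subtracting its image leaves an equation one
  dimension lower.\<close>

lemma triangular_solve:
  fixes T :: "'a :: field poly \<Rightarrow> 'a poly"
  assumes add: "\<And>p q. T (p + q) = T p + T q"
    and scale: "\<And>c p. T (Polynomial.smult c p) = Polynomial.smult c (T p)"
    and upper: "\<And>c r. c < r \<Longrightarrow> poly.coeff (T (Polynomial.monom 1 c)) r = 0"
    and diag: "\<And>c. c < m \<Longrightarrow> poly.coeff (T (Polynomial.monom 1 c)) c \<noteq> 0"
    and bound: "\<And>i. i \<ge> m \<Longrightarrow> poly.coeff Q i = 0"
  shows "\<exists>!D. (\<forall>i\<ge>m. poly.coeff D i = 0) \<and> T D = Q"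
  using diag bound
proof (induction m arbitrary: Q)
  case 0
  have "T 0 = 0"
    using scale[of 0 0] by simp
  moreover have "Q = 0" using 0 by (simp add: poly_eq_iff)
  moreover have "D = 0" if "\<forall>i\<ge>0. poly.coeff D i = 0" for D :: "'a poly"
    using that by (simp add: poly_eq_iff)
  ultimately show ?case by (intro ex1I[of _ 0]) auto
next
  case (Suc m)
  let ?x = "Polynomial.monom 1 m :: 'a poly"
  define t where "t = poly.coeff (T ?x) m"
  have t: "t \<noteq> 0" using Suc.prems(1) by (simp add: t_def)
  define c where "c = poly.coeff Q m / t"
  have split: "T (D + Polynomial.smult d ?x) = T D + Polynomial.smult d (T ?x)" for D d
    by (simp add: add scale)
  \<comment> \<open>Subtracting \<open>c T x\<^sup>m\<close> cancels the coefficient of \<open>x\<^sup>m\<close> in \<open>Q\<close>.\<close>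
  have "poly.coeff (Q - Polynomial.smult c (T ?x)) i = 0" if "i \<ge> m" for i
    using that Suc.prems(2)[of i] upper[of m i] t
    by (cases "i = m") (auto simp: c_def t_def)
  then have IH: "\<exists>!D. (\<forall>i\<ge>m. poly.coeff D i = 0) \<and> T D = Q - Polynomial.smult c (T ?x)"
    using Suc.IH Suc.prems(1) by simp
  then obtain D0 where D0: "\<forall>i\<ge>m. poly.coeff D0 i = 0" "T D0 = Q - Polynomial.smult c (T ?x)"
    by blast
  show ?case
  proof (rule ex1I[of _ "D0 + Polynomial.smult c ?x"])
    show "(\<forall>i\<ge>Suc m. poly.coeff (D0 + Polynomial.smult c ?x) i = 0)
        \<and> T (D0 + Polynomial.smult c ?x) = Q"
      using D0 by (simp add: split)
  next
    fix D assume D: "(\<forall>i\<ge>Suc m. poly.coeff D i = 0) \<and> T D = Q"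
    define d where "d = poly.coeff D m"
    define E where "E = D - Polynomial.smult d ?x"
    have E0: "poly.coeff E i = 0" if "i \<ge> m" for i
      using that D by (cases "i = m") (auto simp: E_def d_def)
    have DE: "D = E + Polynomial.smult d ?x" by (simp add: E_def)
    have TE: "T E = Q - Polynomial.smult d (T ?x)"
      using D split[of E d] by (simp add: DE[symmetric])
    \<comment> \<open>\<open>T E\<close> has degree less than \<open>m\<close>, hence \<open>d\<close> is forced by the coefficient of \<open>x\<^sup>m\<close>.\<close>
    have "poly.coeff (T E) m = 0"
      by (subst coeff_linear_map[OF add scale E0]) (auto intro!: sum.neutral simp: upper)
    then have "d = c" using t by (simp add: TE c_def t_def field_simps)
    then have "E = D0" using IH E0 TE D0 by blast
    then show "D = D0 + Polynomial.smult c ?x" using DE \<open>d = c\<close> by simp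
  qed
qed

section \<open>The matrix of the differential operator\<close>

lemma higher_pderiv_monom_choose:
  "(pderiv ^^ i) (Polynomial.monom (1 :: 'a :: {comm_semiring_1, semiring_no_zero_divisors, semiring_char_0}) c)
    = Polynomial.monom (of_nat (c choose i) * fact i) (c - i)"
proof (induction i)
  case (Suc i)
  have "(c - i) * (c choose i) = (c choose Suc i) * Suc i"
    by (metis Suc_times_binomial_eq binomial_absorb_comp binomial_absorption mult.commute)
  then have "of_nat (c - i) * (of_nat (c choose i) * fact i)
      = (of_nat (c choose Suc i) * fact (Suc i) :: 'a)"
    by (metis (no_types, lifting) fact_Suc mult.assoc of_nat_mult)
  then show ?case by (simp add: Suc pderiv_monom del: fact_Suc)
qed simp

lemma diff_op_add: "diff_op N a (P + Q) = diff_op N a P + diff_op N a Q"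
  by (simp add: diff_op_def higher_pderiv_add algebra_simps sum.distrib)

lemma diff_op_smult: "diff_op N a (Polynomial.smult c P) = Polynomial.smult c (diff_op N a P)"
  by (simp add: diff_op_def higher_pderiv_smult smult_sum2)

text \<open>The summand \<open>i\<close> of \<open>L\<close> sends \<open>x\<^sup>c\<close> to \<open>(c choose i) i! x\<^sup>c\<^sup>-\<^sup>i a\<^sub>i\<close>, whose coefficient at \<open>x\<^sup>r\<close> involves
  \<open>a\<^sub>i\<^sub>,\<^sub>i\<^sub>-\<^sub>k\<close> with \<open>k = c - r\<close>. The degree bound on \<open>a\<^sub>i\<close> kills it for \<open>r > c\<close>; for \<open>r \<le> c\<close> only
  \<open>k \<le> i \<le> c\<close> contributes.\<close>

lemma coeff_diff_op_monom:
  assumes deg: "\<And>m. 1 \<le> m \<Longrightarrow> m \<le> N \<Longrightarrow> degree (a m) \<le> m"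
  shows "poly.coeff (diff_op N a (Polynomial.monom 1 c)) r = op_matrix N a r c"
proof -
  define w :: "nat \<Rightarrow> complex" where "w i = of_nat (c choose i) * fact i" for i
  have "poly.coeff (diff_op N a (Polynomial.monom 1 c)) r
      = (\<Sum>i = 1..N. if r < c - i then 0 else w i * poly.coeff (a i) (r - (c - i)))"
    by (auto simp: diff_op_def coeff_sum higher_pderiv_monom_choose w_def coeff_monom_mult
        mult.commute[of "a _"] intro!: sum.cong)
  also have "\<dots> = op_matrix N a r c"
  proof (cases "r \<le> c")
    case False
    have "(if r < c - i then 0 else w i * poly.coeff (a i) (r - (c - i))) = 0"
      if "i \<in> {1..N}" for i
    proof (cases "i \<le> c")
      case True
      then have "degree (a i) < r - (c - i)" using deg[of i] that \<open>\<not> r \<le> c\<close> by simp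
      then show ?thesis by (simp add: coeff_eq_0)
    qed (simp add: w_def)
    then show ?thesis using False by (simp add: op_matrix_def)
  next
    case True
    have "(\<Sum>i = 1..N. if r < c - i then 0 else w i * poly.coeff (a i) (r - (c - i)))
        = (\<Sum>i = c - r..c. w i * op_coeff N a i (i - (c - r)))"
    proof (rule sum.mono_neutral_cong)
      show "w i * op_coeff N a i (i - (c - r)) = 0" if "i \<in> {c - r..c} - {1..N}" for i
        using that by (auto simp: op_coeff_def)
      show "(if r < c - i then 0 else w i * poly.coeff (a i) (r - (c - i))) = 0"
        if "i \<in> {1..N} - {c - r..c}" for i
        using that True by (auto simp: w_def)
      show "(if r < c - i then 0 else w i * poly.coeff (a i) (r - (c - i)))
          = w i * op_coeff N a i (i - (c - r))" if "i \<in> {1..N} \<inter> {c - r..c}" for i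
      proof -
        have "r - (c - i) = i - (c - r)" "\<not> r < c - i" using that True by auto
        then show ?thesis using that by (simp add: op_coeff_def)
      qed
    qed simp_all
    also have "\<dots> = op_delta N a c (c - r)" by (simp add: op_delta_def w_def)
    \<comment> \<open>Beyond the band, \<open>c - r > N\<close>, every \<open>i \<ge> c - r\<close> exceeds the order of the operator.\<close>
    also have "\<dots> = op_matrix N a r c"
      using True by (auto simp: op_matrix_def op_delta_def op_coeff_def intro!: sum.neutral)
    finally show ?thesis .
  qed
  finally show ?thesis .
qed

lemma op_matrix_below_diagonal: "c < r \<Longrightarrow> op_matrix N a r c = 0"
  by (simp add: op_matrix_def)

lemma op_matrix_diagonal: "op_matrix N a c c = eig_val N a c"
proof -
  have "(\<Sum>i = 0..c. of_nat (c choose i) * fact i * op_coeff N a i i)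
      = (\<Sum>i = 1..min c N. of_nat (c choose i) * fact i * op_coeff N a i i)"
    by (rule sum.mono_neutral_right) (auto simp: op_coeff_def)
  then show ?thesis by (simp add: op_matrix_def op_delta_def eig_val_def)
qed

lemma coeff_diff_op:
  assumes "\<And>m. 1 \<le> m \<Longrightarrow> m \<le> N \<Longrightarrow> degree (a m) \<le> m"
    and "degree P \<le> n"
  shows "poly.coeff (diff_op N a P) r = (\<Sum>c<Suc n. op_matrix N a r c * poly.coeff P c)"
proof -
  have "poly.coeff P i = 0" if "i \<ge> Suc n" for i
    using that assms(2) by (simp add: coeff_eq_0)
  from coeff_linear_map[where T = "diff_op N a", OF diff_op_add diff_op_smult this]
  show ?thesis by (simp add: coeff_diff_op_monom[OF assms(1)] mult.commute)
qed

lemma op_submatrix_mult_coeffs: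
  assumes "\<And>m. 1 \<le> m \<Longrightarrow> m \<le> N \<Longrightarrow> degree (a m) \<le> m"
    and "degree P \<le> n"
  shows "op_submatrix N a (n + 1) *\<^sub>v vec (n + 1) (poly.coeff P)
    = vec (n + 1) (poly.coeff (diff_op N a P))"
  by (rule eq_vecI)
    (auto simp: op_submatrix_def scalar_prod_def coeff_diff_op[OF assms] atLeast0LessThan)

section \<open>Eigenpolynomials\<close>

text \<open>Puts the unknown into the linear space of polynomials of degree less than \<open>n\<close>, the form in which
  \<open>triangular_solve\<close> can be applied.\<close>

lemma monic_eigenpoly_split:
  "monic_eigenpoly N a n P \<longleftrightarrow>
    (\<forall>i\<ge>n. poly.coeff (P - Polynomial.monom 1 n) i = 0) \<and>
    diff_op N a P = Polynomial.smult (eig_val N a n) P"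
proof -
  have "(degree P = n \<and> lead_coeff P = 1) \<longleftrightarrow>
      (\<forall>i\<ge>n. poly.coeff (P - Polynomial.monom 1 n) i = 0)"
  proof
    assume "degree P = n \<and> lead_coeff P = 1"
    then show "\<forall>i\<ge>n. poly.coeff (P - Polynomial.monom 1 n) i = 0"
      by (auto simp: coeff_eq_0)
  next
    assume *: "\<forall>i\<ge>n. poly.coeff (P - Polynomial.monom 1 n) i = 0"
    then have top: "poly.coeff P n = 1" by auto
    have "degree P \<le> n" by (rule degree_le) (use * in auto)
    moreover have "n \<le> degree P" using top by (intro le_degree) simp
    ultimately show "degree P = n \<and> lead_coeff P = 1" using top by simp
  qed
  then show ?thesis by (auto simp: monic_eigenpoly_def)
qed

lemma ex1_monic_eigenpoly:
  assumes deg: "\<And>m. 1 \<le> m \<Longrightarrow> m \<le> N \<Longrightarrow> degree (a m) \<le> m"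
    and simple: "\<And>j. j < n \<Longrightarrow> eig_val N a n \<noteq> eig_val N a j"
  shows "\<exists>!P. monic_eigenpoly N a n P"
proof -
  let ?x = "Polynomial.monom 1 n :: complex poly"
  define T where "T P = diff_op N a P - Polynomial.smult (eig_val N a n) P" for P
  have T_add: "T (P + Q) = T P + T Q" for P Q
    by (simp add: T_def diff_op_add smult_add_right)
  have T_smult: "T (Polynomial.smult c P) = Polynomial.smult c (T P)" for c P
    by (simp add: T_def diff_op_smult smult_diff_right mult.commute)
  have coeff_T: "poly.coeff (T (Polynomial.monom 1 c)) r
      = op_matrix N a r c - (if r = c then eig_val N a n else 0)" for c r
    by (simp add: T_def coeff_diff_op_monom[OF deg])
  have "\<exists>!D. (\<forall>i\<ge>n. poly.coeff D i = 0) \<and> T D = - T ?x"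
  proof (rule triangular_solve[OF T_add T_smult])
    show "poly.coeff (T (Polynomial.monom 1 c)) r = 0" if "c < r" for c r
      using that by (simp add: coeff_T op_matrix_below_diagonal)
    show "poly.coeff (T (Polynomial.monom 1 c)) c \<noteq> 0" if "c < n" for c
      using simple[OF that] by (simp add: coeff_T op_matrix_diagonal)
    show "poly.coeff (- T ?x) i = 0" if "i \<ge> n" for i
      using that by (auto simp: coeff_T op_matrix_diagonal op_matrix_below_diagonal)
  qed
  moreover have "monic_eigenpoly N a n P \<longleftrightarrow>
      (\<forall>i\<ge>n. poly.coeff (P - ?x) i = 0) \<and> T (P - ?x) = - T ?x" for P
  proof -
    have "T P = T (P - ?x) + T ?x" using T_add[of "P - ?x" ?x] by simp
    then have "T (P - ?x) = - T ?x \<longleftrightarrow> T P = 0" by (simp add: eq_neg_iff_add_eq_0)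
    then show ?thesis unfolding monic_eigenpoly_split by (simp add: T_def)
  qed
  ultimately show ?thesis by (metis add_diff_cancel diff_add_cancel)
qed

theorem theorem2:
  fixes N n :: nat and a :: "nat \<Rightarrow> complex poly"
  assumes "N \<ge> 1"
    and "\<And>m. 1 \<le> m \<Longrightarrow> m \<le> N \<Longrightarrow> degree (a m) \<le> m"
    and "n \<ge> 1"
    and "\<And>j. j < n \<Longrightarrow> eig_val N a n \<noteq> eig_val N a j"
  shows "(\<exists>!P. monic_eigenpoly N a n P) \<and>
    (\<forall>P. monic_eigenpoly N a n P \<longrightarrow>
      (let b = vec (n + 1) (poly.coeff P) in
        b $ n = 1 \<and>
        eigenvector (op_submatrix N a (n + 1)) b (eig_val N a n) \<and>
        (op_submatrix N a (n + 1) - eig_val N a n \<cdot>\<^sub>m 1\<^sub>m (n + 1)) *\<^sub>v b = 0\<^sub>v (n + 1)))"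
proof (intro conjI allI impI)
  show "\<exists>!P. monic_eigenpoly N a n P"
    using assms(2,4) by (rule ex1_monic_eigenpoly)
next
  fix P assume P: "monic_eigenpoly N a n P"
  define b where "b = vec (n + 1) (poly.coeff P)"
  let ?A = "op_submatrix N a (n + 1)" and ?e = "eig_val N a n"
  have A: "?A \<in> carrier_mat (n + 1) (n + 1)" by (simp add: op_submatrix_def)
  have b: "b \<in> carrier_vec (n + 1)" by (simp add: b_def)
  have top: "b $ n = 1" using P by (auto simp: b_def monic_eigenpoly_def)
  then have nz: "b \<noteq> 0\<^sub>v (n + 1)" by auto
  have "?A *\<^sub>v b = vec (n + 1) (poly.coeff (diff_op N a P))"
    unfolding b_def
    by (rule op_submatrix_mult_coeffs) (use assms(2) P in \<open>auto simp: monic_eigenpoly_def\<close>)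
  also have "\<dots> = ?e \<cdot>\<^sub>v b"
    using P by (intro eq_vecI) (auto simp: b_def monic_eigenpoly_def)
  finally have eig: "?A *\<^sub>v b = ?e \<cdot>\<^sub>v b" .
  have "(?A - ?e \<cdot>\<^sub>m 1\<^sub>m (n + 1)) *\<^sub>v b = ?A *\<^sub>v b - (?e \<cdot>\<^sub>m 1\<^sub>m (n + 1)) *\<^sub>v b"
    by (rule minus_mult_distrib_mat_vec[OF A _ b]) simp
  also have "(?e \<cdot>\<^sub>m 1\<^sub>m (n + 1)) *\<^sub>v b = ?e \<cdot>\<^sub>v b"
    using b by (intro eq_vecI) auto
  also have "?A *\<^sub>v b - ?e \<cdot>\<^sub>v b = 0\<^sub>v (n + 1)"
    unfolding eig using b by (intro minus_cancel_vec) simp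
  finally have ker: "(?A - ?e \<cdot>\<^sub>m 1\<^sub>m (n + 1)) *\<^sub>v b = 0\<^sub>v (n + 1)" .
  have "eigenvector ?A b ?e"
    using A b nz eig by (simp add: eigenvector_def)
  then show "let b = vec (n + 1) (poly.coeff P) in
        b $ n = 1 \<and>
        eigenvector (op_submatrix N a (n + 1)) b (eig_val N a n) \<and>
        (op_submatrix N a (n + 1) - eig_val N a n \<cdot>\<^sub>m 1\<^sub>m (n + 1)) *\<^sub>v b = 0\<^sub>v (n + 1)"
    using top ker by (simp add: Let_def b_def)
qed

end
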